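(* Let $t\ge 0$. For $0\le k\le t$, the generating function (in $z$, marking length) of the partial Łukasiewicz paths read from right to left, of height at most $t$, ending at height $k$, is $$[u^k]\mathit{Total}_t(z,u)=(-1)^kz^k\frac{N_1^{t-k}+N_2^{t-k}+N_3^{t-k}}{D_t}.$$ For $t\ge 2$, the generating function for the total number of partial Łukasiewicz paths read from right to left of height at most $t$ (with arbitrary end point) is $$\mathit{Total}_t(z,1)=\frac{D_{t-2}}{D_t},$$ while $\mathit{Total}_0(z,1)=\frac{1}{1-z}$ and $\mathit{Total}_1(z,1)=\frac{1}{1-2z}$.
   Context: A partial Łukasiewicz path read from right to left, of length $n\ge0$, is a lattice path starting at $(0,0)$, consisting of $n$ steps from $\{(1,j): j\in\mathbb{Z},\ j\le 1\}$, and never going below the $x$-axis. Its height is the maximal $y$-coordinate of its points; it ends at height $k$ if its end point has $y$-coordinate $k$. $\mathit{Total}_t(z,u)$ is the bivariate generating function of all such paths (including the empty one) of height at most $t$, with $z$ marking the length and $u$ marking the height of the end point; $[u^k]$ denotes coefficient extraction. The polynomials $D_t,N_1^t,N_2^t,N_3^t\in\mathbb{Z}[z]$ ($t\ge0$; superscripts on $N$ are indices, not powers) are defined as follows: $N_1^t=D_t$, and $D_t$, $N_2^t$, $N_3^t$ each satisfy the recurrence $X_{t+2}+X_{t+1}+zX_t=0$ for $t\ge0$, with initial values $D_0=z-1,\ D_1=1-2z$; $\ N_2^0=0,\ N_2^1=z^2$; $\ N_3^0=-z,\ N_3^1=z(1-z)$. *)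

theory Defs
  imports "HOL-Computational_Algebra.Computational_Algebra"
begin

text \<open>
  A path starting at the origin is encoded by the list of the second components of its
  steps: the entry \<open>j\<close> stands for the step \<open>(1, j)\<close>. The \<open>i\<close>-th point of the path
  \<open>js\<close> is therefore \<open>(i, ordinate js i)\<close>, for \<open>i \<le> length js\<close>.
\<close>

definition ordinate :: "int list \<Rightarrow> nat \<Rightarrow> int" where
  "ordinate js i = sum_list (take i js)"

definition luk_path :: "int list \<Rightarrow> bool" where
  "luk_path js \<longleftrightarrow> (\<forall>j\<in>set js. j \<le> 1) \<and> (\<forall>i\<le>length js. 0 \<le> ordinate js i)"

definition height :: "int list \<Rightarrow> int" where
  "height js = Max (ordinate js ` {..length js})"

definition end_height :: "int list \<Rightarrow> int" where
  "end_height js = ordinate js (length js)"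

definition luk_paths :: "nat \<Rightarrow> nat \<Rightarrow> int list set" where
  "luk_paths t n = {js. luk_path js \<and> length js = n \<and> height js \<le> int t}"

text \<open>
  Bivariate generating functions are power series in \<open>z\<close> whose coefficients are polynomials
  in \<open>u\<close>: the set of paths of a given length and bounded height is finite. The application
  of \<open>nat\<close> loses nothing, because paths end at a nonnegative height. Rational coefficients
  make quotients of power series with nonzero constant term available.
\<close>

definition Total :: "nat \<Rightarrow> rat poly fps" where
  "Total t = Abs_fps (\<lambda>n. \<Sum>js\<in>luk_paths t n. monom 1 (nat (end_height js)))"

definition u_coeff :: "nat \<Rightarrow> 'a::zero poly fps \<Rightarrow> 'a fps" where
  "u_coeff k F = Abs_fps (\<lambda>n. coeff (fps_nth F n) k)"

definition u_eval :: "'a::comm_semiring_0 \<Rightarrow> 'a poly fps \<Rightarrow> 'a fps" where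
  "u_eval c F = Abs_fps (\<lambda>n. poly (fps_nth F n) c)"

fun D :: "nat \<Rightarrow> int poly" where
  "D 0 = [:-1, 1:]"
| "D (Suc 0) = [:1, -2:]"
| "D (Suc (Suc t)) = - D (Suc t) - [:0, 1:] * D t"

definition N1 :: "nat \<Rightarrow> int poly" where
  "N1 t = D t"

fun N2 :: "nat \<Rightarrow> int poly" where
  "N2 0 = 0"
| "N2 (Suc 0) = [:0, 0, 1:]"
| "N2 (Suc (Suc t)) = - N2 (Suc t) - [:0, 1:] * N2 t"

fun N3 :: "nat \<Rightarrow> int poly" where
  "N3 0 = [:0, -1:]"
| "N3 (Suc 0) = [:0, 1:] * [:1, -1:]"
| "N3 (Suc (Suc t)) = - N3 (Suc t) - [:0, 1:] * N3 t"

definition ser :: "int poly \<Rightarrow> rat fps" where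
  "ser p = fps_of_poly (map_poly of_int p)"

end

theory Submission
  imports Defs
begin

text \<open>
  Removing the last step of a nonempty path that ends at height \<open>k\<close> leaves a path that ends at
  some height \<open>i \<ge> k - 1\<close>, and every such path arises in this way exactly once, because the
  step \<open>k - i \<le> 1\<close> is determined by its end points. Hence the
  generating functions \<open>F k\<close> of the paths of height at most \<open>t\<close> that end at height
  \<open>k \<le> t\<close> satisfy the linear system
  \<open>F k = (if k = 0 then 1 else 0) + z * (\<Sum>i = k - 1..t. F i)\<close>
  (\<open>card_paths_ending_Suc\<close>, \<open>fps_paths_ending_system\<close>). Because of the factor \<open>z\<close>, the system
  determines the coefficients of \<open>F\<close> one after the other, so that it has only one solution
  (\<open>path_system_unique\<close>), and it suffices to check that the claimed quotients solve it.

  This check becomes uniform once the recurrence for \<open>D\<close> is run backwards: it gives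
  \<open>D\<^bsub>-1\<^esub> = 1\<close> and \<open>D\<^bsub>-2\<^esub> = -1\<close>. With \<open>E s = D\<^bsub>s-2\<^esub>\<close>, the sum
  of the three numerators at \<open>s\<close> is \<open>-E (s + 1)\<close>, so that the claim reads
  \<open>F k = -(-z)^k * E (t - k + 1) / E (t + 2)\<close>. The recurrence for \<open>E\<close> makes sums of the
  right-hand side collapse to a single term (\<open>sum_E_tail\<close>), which proves the system, and the sum over all
  \<open>k\<close> is \<open>E t / E (t + 2)\<close>, the generating function of all paths.
\<close>

section \<open>Removing the last step\<close>

lemma luk_paths_iff:
  "js \<in> luk_paths t n \<longleftrightarrow> length js = n \<and> (\<forall>j\<in>set js. j \<le> 1) \<and>
     (\<forall>i\<le>length js. 0 \<le> ordinate js i \<and> ordinate js i \<le> int t)"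
proof -
  have "height js \<le> int t \<longleftrightarrow> (\<forall>i\<le>length js. ordinate js i \<le> int t)"
    unfolding height_def by (subst Max_le_iff) auto
  then show ?thesis
    unfolding luk_paths_def luk_path_def by blast
qed

lemma end_height_append: "end_height (js @ [j]) = end_height js + j"
  by (simp add: end_height_def ordinate_def)

lemma luk_paths_append_iff:
  "js @ [j] \<in> luk_paths t (Suc n) \<longleftrightarrow>
     js \<in> luk_paths t n \<and> j \<le> 1 \<and> 0 \<le> end_height js + j \<and> end_height js + j \<le> int t"
proof -
  have old: "ordinate (js @ [j]) i = ordinate js i" if "i \<le> length js" for i
    using that by (simp add: ordinate_def)
  have new: "ordinate (js @ [j]) (Suc (length js)) = end_height js + j"
    by (simp add: end_height_def ordinate_def)
  have all: "(\<forall>i\<le>Suc m. P i) \<longleftrightarrow> (\<forall>i\<le>m. P i) \<and> P (Suc m)" for m and P :: "nat \<Rightarrow> bool"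
    by (auto simp: le_Suc_eq)
  show ?thesis
    unfolding luk_paths_iff by (auto simp: all old new)
qed

lemma end_height_bounds:
  assumes "js \<in> luk_paths t n"
  shows "0 \<le> end_height js" "end_height js \<le> int t"
  using assms by (auto simp: luk_paths_iff end_height_def)

definition paths_ending :: "nat \<Rightarrow> nat \<Rightarrow> nat \<Rightarrow> int list set" where
  "paths_ending t n k = {js \<in> luk_paths t n. end_height js = int k}"

lemma luk_paths_eq_UN: "luk_paths t n = (\<Union>k\<le>t. paths_ending t n k)"
proof -
  have "js \<in> (\<Union>k\<le>t. paths_ending t n k)" if "js \<in> luk_paths t n" for js
  proof -
    have "nat (end_height js) \<le> t" "end_height js = int (nat (end_height js))"
      using end_height_bounds[OF that] by auto
    with that show ?thesis
      unfolding paths_ending_def by blast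
  qed
  then show ?thesis
    by (auto simp: paths_ending_def)
qed

text \<open>
  A last step from height \<open>i\<close> to height \<open>k\<close> is admissible if and only if \<open>k - i \<le> 1\<close>. The
  truncated subtraction in the lower bound is harmless: for \<open>k = 0\<close> every height
  \<open>i \<ge> 0\<close> is admissible.
\<close>

lemma paths_ending_Suc:
  assumes "k \<le> t"
  shows "paths_ending t (Suc n) k =
    (\<Union>i\<in>{k - 1..t}. (\<lambda>js. js @ [int k - int i]) ` paths_ending t n i)"
proof (intro equalityI subsetI)
  fix ks assume ks: "ks \<in> paths_ending t (Suc n) k"
  then have "length ks = Suc n"
    by (auto simp: paths_ending_def luk_paths_iff)
  then obtain js j where ks_eq: "ks = js @ [j]"
    by (cases ks rule: rev_cases) auto
  with ks have js: "js \<in> luk_paths t n" and j: "j \<le> 1" "end_height js + j = int k"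
    by (auto simp: paths_ending_def luk_paths_append_iff end_height_append)
  define i where "i = nat (end_height js)"
  have i: "end_height js = int i" "i \<le> t"
    using end_height_bounds[OF js] by (auto simp: i_def)
  then have "i \<in> {k - 1..t}" "js \<in> paths_ending t n i" "j = int k - int i"
    using js j by (auto simp: paths_ending_def)
  then show "ks \<in> (\<Union>i\<in>{k - 1..t}. (\<lambda>js. js @ [int k - int i]) ` paths_ending t n i)"
    using ks_eq by blast
next
  fix ks assume "ks \<in> (\<Union>i\<in>{k - 1..t}. (\<lambda>js. js @ [int k - int i]) ` paths_ending t n i)"
  then show "ks \<in> paths_ending t (Suc n) k"
    using assms by (auto simp: paths_ending_def luk_paths_append_iff end_height_append)
qed

lemma luk_paths_0: "luk_paths t 0 = {[]}"
  by (auto simp: luk_paths_iff ordinate_def)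

lemma finite_luk_paths: "finite (luk_paths t n)"
proof (induction n)
  case 0
  show ?case by (simp add: luk_paths_0)
next
  case (Suc n)
  then have "finite (paths_ending t n i)" for i
    by (simp add: paths_ending_def)
  then show ?case
    by (simp add: luk_paths_eq_UN[of t "Suc n"] paths_ending_Suc)
qed

lemma finite_paths_ending: "finite (paths_ending t n k)"
  by (simp add: paths_ending_def finite_luk_paths)

lemma card_paths_ending_Suc:
  assumes "k \<le> t"
  shows "card (paths_ending t (Suc n) k) = (\<Sum>i = k - 1..t. card (paths_ending t n i))"
proof -
  have "card (paths_ending t (Suc n) k) =
      (\<Sum>i = k - 1..t. card ((\<lambda>js. js @ [int k - int i]) ` paths_ending t n i))"
    unfolding paths_ending_Suc[OF assms]
    by (rule card_UN_disjoint) (auto simp: finite_paths_ending)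
  also have "\<dots> = (\<Sum>i = k - 1..t. card (paths_ending t n i))"
    by (intro sum.cong refl card_image) (simp add: inj_on_def)
  finally show ?thesis .
qed

lemma card_luk_paths: "card (luk_paths t n) = (\<Sum>k\<le>t. card (paths_ending t n k))"
  unfolding luk_paths_eq_UN
  by (rule card_UN_disjoint) (auto simp: finite_paths_ending, auto simp: paths_ending_def)

section \<open>The generating functions and their linear system\<close>

definition fps_paths_ending :: "nat \<Rightarrow> nat \<Rightarrow> rat fps" where
  "fps_paths_ending t k = Abs_fps (\<lambda>n. of_nat (card (paths_ending t n k)))"

lemma u_coeff_Total: "u_coeff k (Total t) = fps_paths_ending t k"
proof (rule fps_ext)
  fix n
  have "u_coeff k (Total t) $ n =
      (\<Sum>js\<in>luk_paths t n. if nat (end_height js) = k then 1 else 0)"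
    by (simp add: u_coeff_def Total_def coeff_sum)
  also have "\<dots> = (\<Sum>js\<in>luk_paths t n. if end_height js = int k then 1 else 0)"
    by (intro sum.cong refl) (use end_height_bounds in force)
  also have "\<dots> = fps_paths_ending t k $ n"
    by (simp add: fps_paths_ending_def paths_ending_def sum.If_cases finite_luk_paths Int_def)
  finally show "u_coeff k (Total t) $ n = fps_paths_ending t k $ n" .
qed

lemma u_eval_1_Total: "u_eval 1 (Total t) = Abs_fps (\<lambda>n. of_nat (card (luk_paths t n)))"
  by (rule fps_ext) (simp add: u_eval_def Total_def poly_sum poly_monom)

lemma u_eval_1_Total_eq_sum: "u_eval 1 (Total t) = (\<Sum>k\<le>t. fps_paths_ending t k)"
  by (rule fps_ext)
    (simp add: u_eval_1_Total card_luk_paths fps_paths_ending_def fps_sum_nth)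

definition path_system :: "nat \<Rightarrow> (nat \<Rightarrow> 'a::comm_ring_1 fps) \<Rightarrow> bool" where
  "path_system t F \<longleftrightarrow>
     (\<forall>k\<le>t. F k = (if k = 0 then 1 else 0) + fps_X * (\<Sum>i = k - 1..t. F i))"

lemma fps_paths_ending_system: "path_system t (fps_paths_ending t)"
  unfolding path_system_def
proof (intro allI impI fps_ext)
  fix k n assume k: "k \<le> t"
  show "fps_paths_ending t k $ n =
    ((if k = 0 then 1 else 0) + fps_X * (\<Sum>i = k - 1..t. fps_paths_ending t i)) $ n"
  proof (cases n)
    case 0
    have "paths_ending t 0 k = (if k = 0 then {[]} else {})"
      by (auto simp: paths_ending_def luk_paths_0 end_height_def ordinate_def)
    then show ?thesis
      by (simp add: 0 fps_paths_ending_def)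
  next
    case (Suc m)
    then show ?thesis
      by (simp add: fps_paths_ending_def card_paths_ending_Suc[OF k] fps_sum_nth)
  qed
qed

text \<open>
  The factor \<open>fps_X\<close> expresses the coefficients of index \<open>n + 1\<close> by those of index \<open>n\<close>.
\<close>

lemma path_system_unique:
  assumes "path_system t F" "path_system t G" "k \<le> t"
  shows "F k = G k"
proof -
  have "\<forall>k\<le>t. F k $ n = G k $ n" for n
  proof (induction n)
    case 0
    show ?case
    proof (intro allI impI)
      fix k assume "k \<le> t"
      then have "F k = (if k = 0 then 1 else 0) + fps_X * (\<Sum>i = k - 1..t. F i)"
        "G k = (if k = 0 then 1 else 0) + fps_X * (\<Sum>i = k - 1..t. G i)"
        using assms(1,2) unfolding path_system_def by blast+
      from this[THEN arg_cong, of "\<lambda>f. f $ 0"] show "F k $ 0 = G k $ 0"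
        by simp
    qed
  next
    case (Suc n)
    show ?case
    proof (intro allI impI)
      fix k assume "k \<le> t"
      then have "F k = (if k = 0 then 1 else 0) + fps_X * (\<Sum>i = k - 1..t. F i)"
        "G k = (if k = 0 then 1 else 0) + fps_X * (\<Sum>i = k - 1..t. G i)"
        using assms(1,2) unfolding path_system_def by blast+
      from this[THEN arg_cong, of "\<lambda>f. f $ Suc n"] Suc.IH
      show "F k $ Suc n = G k $ Suc n"
        by (simp add: fps_sum_nth)
    qed
  qed
  with assms(3) show ?thesis
    by (simp add: fps_eq_iff)
qed

section \<open>The solution of the system\<close>

text \<open>
  \<open>E s\<close> is \<open>D\<^bsub>s-2\<^esub>\<close>, where the recurrence defines the values at the indices
  \<open>-2\<close> and \<open>-1\<close>.
\<close>

fun E :: "nat \<Rightarrow> rat fps" where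
  "E 0 = - 1"
| "E (Suc 0) = 1"
| "E (Suc (Suc s)) = - E (Suc s) - fps_X * E s"

lemma ser_nth: "ser p $ n = of_int (coeff p n)"
  by (simp add: ser_def coeff_map_poly)

lemma ser_recurrence: "ser (- p - [:0, 1:] * q) = - ser p - fps_X * ser q"
  by (rule fps_ext) (auto simp: ser_nth coeff_pCons split: nat.split)

lemma ser_D: "ser (D t) = E (t + 2)"
proof (induction t rule: D.induct)
  case 1
  show ?case
    by (rule fps_ext) (auto simp: ser_nth coeff_pCons eval_nat_numeral split: nat.split)
next
  case 2
  show ?case
    by (rule fps_ext) (auto simp: ser_nth coeff_pCons eval_nat_numeral fps_numeral_nth
        split: nat.split)
next
  case (3 t)
  then show ?case
    by (simp only: D.simps ser_recurrence) (simp add: eval_nat_numeral)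
qed

lemma ser_N: "ser (N1 t + N2 t + N3 t) = - E (t + 1)"
proof (induction t rule: D.induct)
  case 1
  show ?case
    by (rule fps_ext) (auto simp: ser_nth N1_def coeff_pCons eval_nat_numeral split: nat.split)
next
  case 2
  show ?case
    by (rule fps_ext) (auto simp: ser_nth N1_def coeff_pCons eval_nat_numeral fps_numeral_nth
        split: nat.split)
next
  case (3 t)
  have "N1 (Suc (Suc t)) + N2 (Suc (Suc t)) + N3 (Suc (Suc t)) =
      - (N1 (Suc t) + N2 (Suc t) + N3 (Suc t)) - [:0, 1:] * (N1 t + N2 t + N3 t)"
    by (simp add: N1_def algebra_simps)
  with 3 show ?case
    by (simp only: ser_recurrence) (simp add: algebra_simps)
qed

text \<open>
  Division by \<open>E s\<close> is therefore multiplication by an inverse in the ring of power series.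
\<close>

lemma E_nth_0_nonzero: "E s $ 0 \<noteq> 0"
  by (induction s rule: E.induct) simp_all

text \<open>
  The sum for \<open>s + 1\<close> arises from the sum for \<open>s\<close> by multiplication with \<open>-z\<close> and addition
  of \<open>-E (s + 2)\<close>; by the recurrence this turns \<open>E s\<close> into \<open>E (s + 1)\<close>.
\<close>

lemma sum_E: "(\<Sum>i = 0..s. - ((- fps_X) ^ i * E (Suc s - i))) = E s"
proof (induction s)
  case 0
  show ?case by simp
next
  case (Suc s)
  have "(\<Sum>i = 0..Suc s. - ((- fps_X) ^ i * E (Suc (Suc s) - i))) =
      - E (Suc (Suc s)) + (- fps_X) * (\<Sum>i = 0..s. - ((- fps_X) ^ i * E (Suc s - i)))"
    by (subst sum.atLeast0_atMost_Suc_shift) (simp add: sum_distrib_left sum_negf mult.assoc)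
  also have "\<dots> = E (Suc s)"
    unfolding Suc.IH by simp
  finally show ?case .
qed

lemma sum_E_tail:
  assumes "j \<le> t"
  shows "(\<Sum>i = j..t. - ((- fps_X) ^ i * E (Suc t - i))) = (- fps_X) ^ j * E (t - j)"
proof -
  obtain s where t: "t = s + j"
    using assms by (metis le_add_diff_inverse2)
  have "(\<Sum>i = 0 + j..s + j. - ((- fps_X) ^ i * E (Suc t - i))) =
      (\<Sum>i = 0..s. - ((- fps_X) ^ (i + j) * E (Suc t - (i + j))))"
    by (rule sum.shift_bounds_cl_nat_ivl)
  also have "\<dots> = (- fps_X) ^ j * (\<Sum>i = 0..s. - ((- fps_X) ^ i * E (Suc s - i)))"
    unfolding sum_distrib_left
    by (rule sum.cong) (auto simp: t power_add algebra_simps)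
  finally show ?thesis
    unfolding sum_E by (simp add: t)
qed

definition solution :: "nat \<Rightarrow> nat \<Rightarrow> rat fps" where
  "solution t k = - ((- fps_X) ^ k * E (Suc t - k)) / E (t + 2)"

lemma sum_solution:
  assumes "j \<le> t"
  shows "(\<Sum>i = j..t. solution t i) = (- fps_X) ^ j * E (t - j) / E (t + 2)"
  unfolding solution_def sum_E_tail[OF assms, symmetric]
  using E_nth_0_nonzero[of "t + 2"] by (simp add: fps_divide_unit sum_distrib_right)

lemma solution_system: "path_system t (solution t)"
  unfolding path_system_def
proof (intro allI impI)
  fix k assume k: "k \<le> t"
  have unit: "E (t + 2) $ 0 \<noteq> 0"
    by (rule E_nth_0_nonzero)
  show "solution t k =
    (if k = 0 then 1 else 0) + fps_X * (\<Sum>i = k - 1..t. solution t i)"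
  proof (cases k)
    case 0
    have "1 + fps_X * (\<Sum>i = k - 1..t. solution t i) =
        E (t + 2) * inverse (E (t + 2)) + fps_X * E t * inverse (E (t + 2))"
      using unit by (simp add: 0 sum_solution fps_divide_unit inverse_mult_eq_1' mult.assoc)
    also have "\<dots> = (E (t + 2) + fps_X * E t) * inverse (E (t + 2))"
      by (rule distrib_right[symmetric])
    also have "E (t + 2) + fps_X * E t = - E (Suc t)"
      by simp
    finally show ?thesis
      using unit by (simp add: 0 solution_def fps_divide_unit)
  next
    case (Suc j)
    then have "Suc t - k = t - j"
      by simp
    moreover have "(\<Sum>i = j..t. solution t i) = (- fps_X) ^ j * E (t - j) / E (t + 2)"
      using Suc k by (intro sum_solution) simp
    ultimately show ?thesis
      using unit Suc by (simp add: solution_def fps_divide_unit mult.assoc)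
  qed
qed

lemma fps_paths_ending_eq_solution: "k \<le> t \<Longrightarrow> fps_paths_ending t k = solution t k"
  by (rule path_system_unique[OF fps_paths_ending_system solution_system])

lemma solution_eq_numerators:
  assumes "k \<le> t"
  shows "solution t k =
    (- 1) ^ k * fps_X ^ k * (ser (N1 (t - k) + N2 (t - k) + N3 (t - k)) / ser (D t))"
proof -
  have "(- 1) ^ k * fps_X ^ k = ((- fps_X) ^ k :: rat fps)"
    by (rule power_minus[symmetric])
  moreover have "Suc t - k = t - k + 1"
    using assms by simp
  ultimately show ?thesis
    using E_nth_0_nonzero[of "t + 2"]
    by (simp add: solution_def ser_N ser_D fps_divide_unit mult.assoc del: E.simps)
qed

lemma u_eval_1_Total_eq: "u_eval 1 (Total t) = E t / E (t + 2)"
proof -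
  have "u_eval 1 (Total t) = (\<Sum>k = 0..t. solution t k)"
    unfolding u_eval_1_Total_eq_sum atMost_atLeast0
    by (rule sum.cong) (auto simp: fps_paths_ending_eq_solution)
  then show ?thesis
    by (simp add: sum_solution del: E.simps)
qed

theorem theorem6:
  shows "(\<forall>t k. k \<le> t \<longrightarrow>
            Abs_fps (\<lambda>n. of_nat (card {js \<in> luk_paths t n. end_height js = int k})) = u_coeff k (Total t)
          \<and> u_coeff k (Total t)
              = (- 1) ^ k * fps_X ^ k * (ser (N1 (t - k) + N2 (t - k) + N3 (t - k)) / ser (D t)))
       \<and> (\<forall>t. Abs_fps (\<lambda>n. of_nat (card (luk_paths t n))) = u_eval 1 (Total t))
       \<and> (\<forall>t\<ge>2. u_eval 1 (Total t) = ser (D (t - 2)) / ser (D t))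
       \<and> u_eval 1 (Total 0) = 1 / (1 - fps_X)
       \<and> u_eval 1 (Total 1) = 1 / (1 - 2 * fps_X)"
proof (intro conjI allI impI)
  fix t k :: nat assume k: "k \<le> t"
  show "Abs_fps (\<lambda>n. of_nat (card {js \<in> luk_paths t n. end_height js = int k})) =
      u_coeff k (Total t)"
    by (simp add: u_coeff_Total fps_paths_ending_def paths_ending_def)
  show "u_coeff k (Total t) =
      (- 1) ^ k * fps_X ^ k * (ser (N1 (t - k) + N2 (t - k) + N3 (t - k)) / ser (D t))"
    unfolding u_coeff_Total fps_paths_ending_eq_solution[OF k]
    by (rule solution_eq_numerators[OF k])
next
  fix t
  show "Abs_fps (\<lambda>n. of_nat (card (luk_paths t n))) = u_eval 1 (Total t)"
    by (rule u_eval_1_Total[symmetric])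
next
  fix t :: nat assume "2 \<le> t"
  then show "u_eval 1 (Total t) = ser (D (t - 2)) / ser (D t)"
    by (simp only: u_eval_1_Total_eq ser_D le_add_diff_inverse2)
next
  have "E 0 / E (0 + 2) = - 1 / - (1 - fps_X)"
    by (simp add: eval_nat_numeral)
  also have "\<dots> = 1 / (1 - fps_X)"
    using fps_inverse_minus[of "1 - fps_X :: rat fps"] by (simp add: fps_divide_unit)
  finally show "u_eval 1 (Total 0) = 1 / (1 - fps_X)"
    unfolding u_eval_1_Total_eq .
next
  show "u_eval 1 (Total 1) = 1 / (1 - 2 * fps_X)"
    unfolding u_eval_1_Total_eq by (simp add: eval_nat_numeral algebra_simps)
qed

end
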